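(* Let $\mathbb{K}$ be a field of characteristic zero and let $(\mathfrak{g},B,\omega)$ be a finite-dimensional quadratic symplectic Lie algebra over $\mathbb{K}$. Let $X_0\in\mathfrak{z}(\mathfrak{g})\setminus\{0\}$ be such that $B(X_0,X_0)=0$. Let $\delta$ be the unique invertible skew-symmetric derivation of $(\mathfrak{g},B)$ such that $\omega(X,Y)=B(\delta(X),Y)$ for all $X,Y\in\mathfrak{g}$. Let $(\widetilde{\mathfrak{g}}=\mathbb{K}e\oplus\mathfrak{g}\oplus\mathbb{K}e^*,\widetilde{B})$ be the elementary odd double extension of $(\mathfrak{g},B)$ by the one-dimensional Lie superalgebra $(\mathbb{K}e)_{\bar 1}$ (by means of $X_0$). If there exists $\beta\in\mathbb{K}\setminus\{0\}$ such that $$\delta(X_0)=\beta X_0,$$ then the linear endomorphism $\widetilde{\delta}:\widetilde{\mathfrak{g}}\to\widetilde{\mathfrak{g}}$ defined by $$\widetilde{\delta}(e^* )=-\tfrac{\beta}{2}e^*,\qquad \widetilde{\delta}(e)=\tfrac{\beta}{2}e,\qquad \widetilde{\delta}(X)=\delta(X)\ \text{ for } X\in\mathfrak{g},$$ is an even invertible skew-supersymmetric superderivation of $(\widetilde{\mathfrak{g}},\widetilde{B})$. Consequently, with $\widetilde{\omega}(X,Y):=\widetilde{B}(\widetilde{\delta}(X),Y)$ for $X,Y\in\widetilde{\mathfrak{g}}$, $(\widetilde{\mathfrak{g}},\widetilde{B},\widetilde{\omega})$ is a quadratic symplectic Lie superalgebra of filiform type, i.e. $\widetilde{\mathfrak{g}}_{\bar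 1}$ is a filiform $\widetilde{\mathfrak{g}}_{\bar 0}$-module with the flag $\widetilde{\mathfrak{g}}_{\bar 1}=\widetilde{V}_2\supset\widetilde{V}_1\supset\widetilde{V}_0$, where $\widetilde{V}_2=\mathbb{K}e\oplus\mathbb{K}e^*$, $\widetilde{V}_1=\mathbb{K}e^*$, $\widetilde{V}_0=\{0\}$.
   Context: A Lie superalgebra is a $\mathbb{Z}_2$-graded vector space $\mathfrak{g}=\mathfrak{g}_{\bar 0}\oplus\mathfrak{g}_{\bar 1}$ with an even bilinear bracket satisfying, for homogeneous $X,Y,Z$ of degrees $x,y,z$, $[X,Y]=-(-1)^{xy}[Y,X]$ and $(-1)^{xz}[X,[Y,Z]]+(-1)^{xy}[Y,[Z,X]]+(-1)^{yz}[Z,[X,Y]]=0$. A bilinear form $F$ is even if $F(\mathfrak{g}_{\bar 0},\mathfrak{g}_{\bar 1})=F(\mathfrak{g}_{\bar 1},\mathfrak{g}_{\bar 0})=\{0\}$. $(\mathfrak{g},B)$ is quadratic if $B$ is an even, non-degenerate, supersymmetric ($B(X,Y)=(-1)^{xy}B(Y,X)$), invariant ($B([X,Y],Z)=B(X,[Y,Z])$) bilinear form. A symplectic structure is an even, non-degenerate, skew-supersymmetric ($\omega(X,Y)=-(-1)^{xy}\omega(Y,X)$) bilinear form with $(-1)^{xz}\omega(X,[Y,Z])+(-1)^{yx}\omega(Y,[Z,X])+(-1)^{zy}\omega(Z,[X,Y])=0$. A quadratic symplectic Lie superalgebra $(\mathfrak{g},B,\omega)$ carries both; it is a quadratic symplectic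 Lie algebra when $\mathfrak{g}_{\bar 1}=\{0\}$. An even superderivation is a degree-preserving linear map $D$ with $D([X,Y])=[D(X),Y]+[X,D(Y)]$; it is skew-(super)symmetric if $B(D(X),Y)=-B(X,D(Y))$. The symplectic structures on a quadratic $(\mathfrak{g},B)$ are exactly the forms $B(\delta(\cdot),\cdot)$ with $\delta$ an even invertible skew-supersymmetric superderivation. $\mathfrak{z}(\mathfrak{g})$ denotes the center. Elementary odd double extension: for a quadratic Lie algebra $(\mathfrak{g},B)$ and $X_0\in\mathfrak{z}(\mathfrak{g})\setminus\{0\}$ with $B(X_0,X_0)=0$, it is $\widetilde{\mathfrak{g}}=\mathbb{K}e\oplus\mathfrak{g}\oplus\mathbb{K}e^*$ with $\widetilde{\mathfrak{g}}_{\bar 0}=\mathfrak{g}$, $\widetilde{\mathfrak{g}}_{\bar 1}=\mathbb{K}e\oplus\mathbb{K}e^*$, brackets $[e,e]=X_0$, $[e^*,\widetilde{\mathfrak{g}}]=\{0\}$, $[e,X]=-B(X,X_0)e^*$, $[X,Y]=[X,Y]_{\mathfrak{g}}$ for $X,Y\in\mathfrak{g}$, and supersymmetric form $\widetilde{B}|_{\mathfrak{g}\times\mathfrak{g}}=B$, $\widetilde{B}(e^*,e)=1$, $\widetilde{B}(\mathfrak{g},e)=\widetilde{B}(\mathfrak{g},e^* )=\{0\}$, $\widetilde{B}(e,e)=\widetilde{B}(e^*,e^* )=0$; this is a quadratic Lie superalgebra. A Lie superalgebra $\mathfrak{g}$ with $\dim\mathfrak{g}_{\bar 1}=m>0$ is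 of filiform type ($\mathfrak{g}_{\bar 1}$ is a filiform $\mathfrak{g}_{\bar 0}$-module) if there is a flag $\mathfrak{g}_{\bar 1}=V_m\supset\dots\supset V_1\supset V_0$ with $\dim V_i=i$ and $[\mathfrak{g}_{\bar 0},V_{i+1}]=V_i$ for $0\le i\le m-1$. *)

theory Defs
  imports "HOL-Analysis.Product_Vector" "HOL-Library.Z2"
begin

text \<open>
  A vector space is a type with a scalar multiplication satisfying the library locale
  \<^locale>\<open>vector_space\<close>. A \<open>\<int>\<^sub>2\<close>-grading of it is a function \<open>G\<close> from the two-element field
  \<^typ>\<open>bit\<close> to sets, so that degrees are added and multiplied modulo 2;
  \<open>ksign (x * y)\<close> is the sign \<open>(-1)\<^sup>x\<^sup>y\<close>.
\<close>

definition ksign :: "bit \<Rightarrow> 'k::field" where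
  "ksign x = (if x = 0 then 1 else - 1)"

definition bilinear_map ::
  "('k::field \<Rightarrow> 'v::ab_group_add \<Rightarrow> 'v) \<Rightarrow> ('k \<Rightarrow> 'w::ab_group_add \<Rightarrow> 'w) \<Rightarrow> ('v \<Rightarrow> 'v \<Rightarrow> 'w) \<Rightarrow> bool" where
  "bilinear_map smul smul' f \<longleftrightarrow>
     (\<forall>X. Vector_Spaces.linear smul smul' (\<lambda>Y. f X Y)) \<and>
     (\<forall>Y. Vector_Spaces.linear smul smul' (\<lambda>X. f X Y))"

definition even_form :: "(bit \<Rightarrow> 'v set) \<Rightarrow> ('v \<Rightarrow> 'v \<Rightarrow> 'k::field) \<Rightarrow> bool" where
  "even_form G F \<longleftrightarrow> (\<forall>X\<in>G 0. \<forall>Y\<in>G 1. F X Y = 0 \<and> F Y X = 0)"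

definition nondegenerate :: "('v::ab_group_add \<Rightarrow> 'v \<Rightarrow> 'k::field) \<Rightarrow> bool" where
  "nondegenerate F \<longleftrightarrow>
     (\<forall>X. (\<forall>Y. F X Y = 0) \<longrightarrow> X = 0) \<and> (\<forall>Y. (\<forall>X. F X Y = 0) \<longrightarrow> Y = 0)"

locale lie_superalgebra = vector_space smul
  for smul :: "'k::field \<Rightarrow> 'v::ab_group_add \<Rightarrow> 'v" +
  fixes G :: "bit \<Rightarrow> 'v set"
    and br :: "'v \<Rightarrow> 'v \<Rightarrow> 'v"
  assumes subspace_grading: "subspace (G x)"
    and grading_Int: "G 0 \<inter> G 1 = {0}"
    and grading_sum: "\<exists>X\<in>G 0. \<exists>Y\<in>G 1. Z = X + Y"
    and bilinear_bracket: "bilinear_map smul smul br"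
    and even_bracket: "X \<in> G x \<Longrightarrow> Y \<in> G y \<Longrightarrow> br X Y \<in> G (x + y)"
    and skew_bracket: "X \<in> G x \<Longrightarrow> Y \<in> G y \<Longrightarrow> br X Y = - smul (ksign (x * y)) (br Y X)"
    and jacobi: "X \<in> G x \<Longrightarrow> Y \<in> G y \<Longrightarrow> Z \<in> G z \<Longrightarrow>
          smul (ksign (x * z)) (br X (br Y Z))
        + smul (ksign (x * y)) (br Y (br Z X))
        + smul (ksign (y * z)) (br Z (br X Y)) = 0"

locale quadratic_lie_superalgebra = lie_superalgebra smul G br
  for smul :: "'k::field \<Rightarrow> 'v::ab_group_add \<Rightarrow> 'v"
    and G :: "bit \<Rightarrow> 'v set"
    and br :: "'v \<Rightarrow> 'v \<Rightarrow> 'v" +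
  fixes B :: "'v \<Rightarrow> 'v \<Rightarrow> 'k"
  assumes bilinear_B: "bilinear_map smul (*) B"
    and even_B: "even_form G B"
    and nondegenerate_B: "nondegenerate B"
    and supersymmetric_B: "X \<in> G x \<Longrightarrow> Y \<in> G y \<Longrightarrow> B X Y = ksign (x * y) * B Y X"
    and invariant_B: "B (br X Y) Z = B X (br Y Z)"

locale symplectic_lie_superalgebra = lie_superalgebra smul G br
  for smul :: "'k::field \<Rightarrow> 'v::ab_group_add \<Rightarrow> 'v"
    and G :: "bit \<Rightarrow> 'v set"
    and br :: "'v \<Rightarrow> 'v \<Rightarrow> 'v" +
  fixes \<omega> :: "'v \<Rightarrow> 'v \<Rightarrow> 'k"
  assumes bilinear_omega: "bilinear_map smul (*) \<omega>"
    and even_omega: "even_form G \<omega>"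
    and nondegenerate_omega: "nondegenerate \<omega>"
    and skew_supersymmetric_omega:
      "X \<in> G x \<Longrightarrow> Y \<in> G y \<Longrightarrow> \<omega> X Y = - (ksign (x * y) * \<omega> Y X)"
    and cocycle_omega: "X \<in> G x \<Longrightarrow> Y \<in> G y \<Longrightarrow> Z \<in> G z \<Longrightarrow>
          ksign (x * z) * \<omega> X (br Y Z)
        + ksign (y * x) * \<omega> Y (br Z X)
        + ksign (z * y) * \<omega> Z (br X Y) = 0"

locale quadratic_symplectic_lie_superalgebra =
  quadratic_lie_superalgebra smul G br B + symplectic_lie_superalgebra smul G br \<omega>
  for smul :: "'k::field \<Rightarrow> 'v::ab_group_add \<Rightarrow> 'v"
    and G :: "bit \<Rightarrow> 'v set"
    and br :: "'v \<Rightarrow> 'v \<Rightarrow> 'v"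
    and B \<omega> :: "'v \<Rightarrow> 'v \<Rightarrow> 'k"

definition purely_even :: "bit \<Rightarrow> 'v::ab_group_add set" where
  "purely_even x = (if x = 0 then UNIV else {0})"

abbreviation quadratic_symplectic_lie_algebra ::
  "('k::field \<Rightarrow> 'v::ab_group_add \<Rightarrow> 'v) \<Rightarrow> ('v \<Rightarrow> 'v \<Rightarrow> 'v) \<Rightarrow> ('v \<Rightarrow> 'v \<Rightarrow> 'k) \<Rightarrow> ('v \<Rightarrow> 'v \<Rightarrow> 'k) \<Rightarrow> bool" where
  "quadratic_symplectic_lie_algebra smul br B \<omega> \<equiv>
     quadratic_symplectic_lie_superalgebra smul purely_even br B \<omega>"

definition center :: "('v::ab_group_add \<Rightarrow> 'v \<Rightarrow> 'v) \<Rightarrow> 'v set" where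
  "center br = {X. \<forall>Y. br X Y = 0}"

definition even_superderivation ::
  "('k::field \<Rightarrow> 'v::ab_group_add \<Rightarrow> 'v) \<Rightarrow> (bit \<Rightarrow> 'v set) \<Rightarrow> ('v \<Rightarrow> 'v \<Rightarrow> 'v) \<Rightarrow> ('v \<Rightarrow> 'v) \<Rightarrow> bool" where
  "even_superderivation smul G br D \<longleftrightarrow>
     Vector_Spaces.linear smul smul D \<and>
     (\<forall>x. D ` G x \<subseteq> G x) \<and>
     (\<forall>X Y. D (br X Y) = br (D X) Y + br X (D Y))"

definition skew_supersymmetric :: "('v \<Rightarrow> 'v \<Rightarrow> 'k::field) \<Rightarrow> ('v \<Rightarrow> 'v) \<Rightarrow> bool" where
  "skew_supersymmetric B D \<longleftrightarrow> (\<forall>X Y. B (D X) Y = - B X (D Y))"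

definition bracket_span ::
  "('k::field \<Rightarrow> 'v::ab_group_add \<Rightarrow> 'v) \<Rightarrow> ('v \<Rightarrow> 'v \<Rightarrow> 'v) \<Rightarrow> 'v set \<Rightarrow> 'v set \<Rightarrow> 'v set" where
  "bracket_span smul br S T = module.span smul {br X Y | X Y. X \<in> S \<and> Y \<in> T}"

definition filiform_flag ::
  "('k::field \<Rightarrow> 'v::ab_group_add \<Rightarrow> 'v) \<Rightarrow> (bit \<Rightarrow> 'v set) \<Rightarrow> ('v \<Rightarrow> 'v \<Rightarrow> 'v) \<Rightarrow> nat \<Rightarrow> (nat \<Rightarrow> 'v set) \<Rightarrow> bool" where
  "filiform_flag smul G br m V \<longleftrightarrow>
     m > 0 \<and> V m = G 1 \<and>
     (\<forall>i\<le>m. module.subspace smul (V i) \<and> vector_space.dim smul (V i) = i) \<and>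
     (\<forall>i<m. V i \<subset> V (Suc i) \<and> bracket_span smul br (G 0) (V (Suc i)) = V i)"

definition filiform_type ::
  "('k::field \<Rightarrow> 'v::ab_group_add \<Rightarrow> 'v) \<Rightarrow> (bit \<Rightarrow> 'v set) \<Rightarrow> ('v \<Rightarrow> 'v \<Rightarrow> 'v) \<Rightarrow> bool" where
  "filiform_type smul G br \<longleftrightarrow> (\<exists>m V. filiform_flag smul G br m V)"

text \<open>
  The elementary odd double extension lives on \<open>'k \<times> 'v \<times> 'k\<close>, where \<open>(a, X, b)\<close> stands
  for \<open>a e + X + b e\<^sup>*\<close>. The bracket and the form below are the bilinear extensions of
  \<open>[e,e] = X\<^sub>0\<close>, \<open>[e,X] = -B(X,X\<^sub>0) e\<^sup>*\<close>, \<open>[X,e] = B(X,X\<^sub>0) e\<^sup>*\<close>, \<open>[e\<^sup>*,-] = [-,e\<^sup>*] = 0\<close> and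
  \<open>B(e\<^sup>*,e) = 1\<close>, \<open>B(e,e\<^sup>*) = -1\<close> (\<open>e\<close> and \<open>e\<^sup>*\<close> are odd).
\<close>

abbreviation dext_scale ::
  "('k::field \<Rightarrow> 'v::ab_group_add \<Rightarrow> 'v) \<Rightarrow> 'k \<Rightarrow> 'k \<times> 'v \<times> 'k \<Rightarrow> 'k \<times> 'v \<times> 'k" where
  "dext_scale smul \<equiv> module_prod.scale (*) (module_prod.scale smul (*))"

definition dext_e :: "'k::field \<times> 'v::ab_group_add \<times> 'k" where
  "dext_e = (1, 0, 0)"

definition dext_estar :: "'k::field \<times> 'v::ab_group_add \<times> 'k" where
  "dext_estar = (0, 0, 1)"

definition dext_incl :: "'v::ab_group_add \<Rightarrow> 'k::field \<times> 'v \<times> 'k" where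
  "dext_incl X = (0, X, 0)"

definition dext_grading ::
  "('k::field \<Rightarrow> 'v::ab_group_add \<Rightarrow> 'v) \<Rightarrow> bit \<Rightarrow> ('k \<times> 'v \<times> 'k) set" where
  "dext_grading smul x =
     (if x = 0 then range dext_incl
      else module.span (dext_scale smul) {dext_e, dext_estar})"

fun dext_bracket ::
  "('k::field \<Rightarrow> 'v::ab_group_add \<Rightarrow> 'v) \<Rightarrow> ('v \<Rightarrow> 'v \<Rightarrow> 'v) \<Rightarrow> ('v \<Rightarrow> 'v \<Rightarrow> 'k) \<Rightarrow> 'v
    \<Rightarrow> 'k \<times> 'v \<times> 'k \<Rightarrow> 'k \<times> 'v \<times> 'k \<Rightarrow> 'k \<times> 'v \<times> 'k" where
  "dext_bracket smul br B X\<^sub>0 (a, X, b) (a', X', b') =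
     (0, smul (a * a') X\<^sub>0 + br X X', a' * B X X\<^sub>0 - a * B X' X\<^sub>0)"

fun dext_form ::
  "('v::ab_group_add \<Rightarrow> 'v \<Rightarrow> 'k::field) \<Rightarrow> 'k \<times> 'v \<times> 'k \<Rightarrow> 'k \<times> 'v \<times> 'k \<Rightarrow> 'k" where
  "dext_form B (a, X, b) (a', X', b') = B X X' + b * a' - a * b'"

fun dext_deriv ::
  "'k::field \<Rightarrow> ('v::ab_group_add \<Rightarrow> 'v) \<Rightarrow> 'k \<times> 'v \<times> 'k \<Rightarrow> 'k \<times> 'v \<times> 'k" where
  "dext_deriv \<beta> \<delta> (a, X, b) = ((\<beta> / 2) * a, \<delta> X, - (\<beta> / 2) * b)"

definition dext_flag ::
  "('k::field \<Rightarrow> 'v::ab_group_add \<Rightarrow> 'v) \<Rightarrow> nat \<Rightarrow> ('k \<times> 'v \<times> 'k) set" where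
  "dext_flag smul i =
     (if i = 0 then {0}
      else if i = 1 then module.span (dext_scale smul) {dext_estar}
      else module.span (dext_scale smul) {dext_e, dext_estar})"

text \<open>The values on generators, as they are prescribed for the double extension and for the
  extended derivation:\<close>

lemma dext_scale_triple:
  assumes "vector_space smul"
  shows "dext_scale smul c (a, X, b) = (c * a, smul c X, c * b)"
proof -
  interpret V: vector_space smul by fact
  interpret K: vector_space "(*) :: 'a \<Rightarrow> 'a \<Rightarrow> 'a"
    by unfold_locales (simp_all add: distrib_left distrib_right)
  interpret P: vector_space_prod smul "(*) :: 'a \<Rightarrow> 'a \<Rightarrow> 'a" ..
  interpret Q: vector_space_prod "(*) :: 'a \<Rightarrow> 'a \<Rightarrow> 'a" P.scale ..
  show ?thesis
    by (simp add: P.scale_prod Q.scale_prod)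
qed

lemma dext_generators:
  assumes "quadratic_lie_superalgebra smul purely_even br B"
  shows "dext_bracket smul br B X\<^sub>0 dext_e dext_e = dext_incl X\<^sub>0"
    and "dext_bracket smul br B X\<^sub>0 dext_estar Z = 0"
    and "dext_bracket smul br B X\<^sub>0 dext_e (dext_incl X) = dext_scale smul (- B X X\<^sub>0) dext_estar"
    and "dext_bracket smul br B X\<^sub>0 (dext_incl X) (dext_incl Y) = dext_incl (br X Y)"
    and "dext_form B (dext_incl X) (dext_incl Y) = B X Y"
    and "dext_form B dext_estar dext_e = 1"
    and "dext_form B (dext_incl X) dext_e = 0" "dext_form B (dext_incl X) dext_estar = 0"
    and "dext_form B dext_e dext_e = 0" "dext_form B dext_estar dext_estar = 0"
    and "dext_deriv \<beta> \<delta> (dext_incl X) = dext_incl (\<delta> X)"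
    and "\<delta> 0 = 0 \<Longrightarrow> dext_deriv \<beta> \<delta> dext_e = dext_scale smul (\<beta> / 2) dext_e"
    and "\<delta> 0 = 0 \<Longrightarrow> dext_deriv \<beta> \<delta> dext_estar = dext_scale smul (- (\<beta> / 2)) dext_estar"
proof -
  interpret quadratic_lie_superalgebra smul purely_even br B by fact
  note V = vector_space_axioms
  have br0: "br 0 Y = 0" "br Y 0 = 0" for Y
    using bilinear_bracket module_hom.zero
    unfolding bilinear_map_def Vector_Spaces.linear_def by fast+
  have B0: "B 0 Y = 0" "B Y 0 = 0" for Y
    using bilinear_B module_hom.zero
    unfolding bilinear_map_def Vector_Spaces.linear_def by fast+
  note [simp] = br0 B0 dext_e_def dext_estar_def dext_incl_def dext_scale_triple[OF V]
  show "dext_bracket smul br B X\<^sub>0 dext_e dext_e = dext_incl X\<^sub>0"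
    and "dext_bracket smul br B X\<^sub>0 dext_e (dext_incl X) = dext_scale smul (- B X X\<^sub>0) dext_estar"
    and "dext_bracket smul br B X\<^sub>0 (dext_incl X) (dext_incl Y) = dext_incl (br X Y)"
    and "dext_form B (dext_incl X) (dext_incl Y) = B X Y"
    and "dext_form B dext_estar dext_e = 1"
    and "dext_form B (dext_incl X) dext_e = 0" "dext_form B (dext_incl X) dext_estar = 0"
    and "dext_form B dext_e dext_e = 0" "dext_form B dext_estar dext_estar = 0"
    and "dext_deriv \<beta> \<delta> (dext_incl X) = dext_incl (\<delta> X)"
    and "\<delta> 0 = 0 \<Longrightarrow> dext_deriv \<beta> \<delta> dext_e = dext_scale smul (\<beta> / 2) dext_e"
    and "\<delta> 0 = 0 \<Longrightarrow> dext_deriv \<beta> \<delta> dext_estar = dext_scale smul (- (\<beta> / 2)) dext_estar"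
    by simp_all
  show "dext_bracket smul br B X\<^sub>0 dext_estar Z = 0"
    by (cases Z) (simp add: zero_prod_def)
qed

end

theory Submission
  imports Defs
begin

text \<open>
  A central isotropic \<open>X\<^sub>0\<close> is orthogonal to itself and to every bracket, so a double bracket in the
  extension only sees the components in the original algebra; this gives the Jacobi identity. For
  an eigenvector \<open>X\<^sub>0\<close> of \<open>\<delta>\<close>, the relation \<open>[e,e] = X\<^sub>0\<close> forces the eigenvalue \<open>\<beta>/2\<close> on \<open>e\<close>, and
  skew-symmetry then forces \<open>-\<beta>/2\<close> on \<open>e\<^sup>*\<close>. The module is filiform because \<open>B\<close> is non-degenerate
  and \<open>X\<^sub>0 \<noteq> 0\<close>, so that \<open>[X,e] = B(X,X\<^sub>0) e\<^sup>*\<close> is nonzero for some \<open>X\<close>.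
\<close>

section \<open>Linearity and bilinearity as equations\<close>

lemma linear_iff_vector_space:
  assumes "vector_space s" "vector_space t"
  shows "Vector_Spaces.linear s t f \<longleftrightarrow>
    (\<forall>x y. f (x + y) = f x + f y) \<and> (\<forall>c x. f (s c x) = t c (f x))"
  using assms by (simp add: Vector_Spaces.linear_iff)

lemma bilinear_map_iff:
  assumes "vector_space s" "vector_space t"
  shows "bilinear_map s t f \<longleftrightarrow>
    (\<forall>x y z. f x (y + z) = f x y + f x z) \<and> (\<forall>c x y. f x (s c y) = t c (f x y)) \<and>
    (\<forall>x y z. f (x + y) z = f x z + f y z) \<and> (\<forall>c x y. f (s c x) y = t c (f x y))"
  unfolding bilinear_map_def linear_iff_vector_space[OF assms] by blast

lemma vector_space_field: "vector_space ((*) :: 'k::field \<Rightarrow> 'k \<Rightarrow> 'k)"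
  by unfold_locales (simp_all add: algebra_simps)

section \<open>Symplectic forms from invertible skew-supersymmetric superderivations\<close>

context quadratic_lie_superalgebra
begin

lemma bracket_linear [simp]:
  "br (X + Y) Z = br X Z + br Y Z" "br Z (X + Y) = br Z X + br Z Y"
  "br (smul c X) Y = smul c (br X Y)" "br X (smul c Y) = smul c (br X Y)"
  using bilinear_bracket
  by (simp_all add: bilinear_map_iff[OF vector_space_axioms vector_space_axioms])

lemma form_linear [simp]:
  "B (X + Y) Z = B X Z + B Y Z" "B Z (X + Y) = B Z X + B Z Y"
  "B (smul c X) Y = c * B X Y" "B X (smul c Y) = c * B X Y"
  using bilinear_B by (simp_all add: bilinear_map_iff[OF vector_space_axioms vector_space_field])

lemma bracket_zero [simp]: "br 0 X = 0" "br X 0 = 0"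
  using bracket_linear(1)[of 0 0 X] bracket_linear(2)[of X 0 0] by simp_all

lemma form_zero [simp]: "B 0 X = 0" "B X 0 = 0"
  using form_linear(3)[of 0 0 X] form_linear(4)[of X 0 0] by simp_all

lemma form_minus [simp]: "B (- X) Y = - B X Y" "B X (- Y) = - B X Y"
  using form_linear(1)[of X "- X" Y] form_linear(2)[of X Y "- Y"]
  by (simp_all add: eq_neg_iff_add_eq_0 add.commute)

text \<open>Skewness of \<open>D\<close> and supersymmetry of \<open>B\<close> make
  \<open>B (D X) Y\<close> skew-supersymmetric; the Leibniz rule becomes the cocycle identity, and
  injectivity of \<open>D\<close> preserves non-degeneracy.\<close>

lemma symplectic_of_superderivation:
  assumes der: "even_superderivation smul G br D" and "bij D" and skew: "skew_supersymmetric B D"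
  shows "quadratic_symplectic_lie_superalgebra smul G br B (\<lambda>X Y. B (D X) Y)"
proof -
  have D_linear: "D (X + Y) = D X + D Y" "D (smul c X) = smul c (D X)" for X Y c
    using der by (simp_all add: even_superderivation_def
        linear_iff_vector_space[OF vector_space_axioms vector_space_axioms])
  have D_mem: "D X \<in> G x" if "X \<in> G x" for X x
    using der that by (auto simp: even_superderivation_def)
  have D_br: "D (br X Y) = br (D X) Y + br X (D Y)" for X Y
    using der by (simp add: even_superderivation_def)
  have D_skew: "B (D X) Y = - B X (D Y)" for X Y
    using skew by (simp add: skew_supersymmetric_def)
  have D_zero: "D X = 0 \<longleftrightarrow> X = 0" for X
    using \<open>bij D\<close> D_linear(2)[of 0 0] by (metis bij_is_inj injD scale_zero_left)
  have nd: "(\<forall>Y. B X Y = 0) \<Longrightarrow> X = 0" "(\<forall>Y. B Y X = 0) \<Longrightarrow> X = 0" for X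
    using nondegenerate_B by (simp_all add: nondegenerate_def)
  show ?thesis
  proof unfold_locales
    show "bilinear_map smul (*) (\<lambda>X Y. B (D X) Y)"
      by (simp add: bilinear_map_iff[OF vector_space_axioms vector_space_field] D_linear)
    show "even_form G (\<lambda>X Y. B (D X) Y)"
      using even_B D_mem by (simp add: even_form_def)
    show "nondegenerate (\<lambda>X Y. B (D X) Y)"
      \<comment> \<open>For a vector in the right kernel, \<open>D\<close> is moved across
        \<open>B\<close> onto it, so both kernels reduce to injectivity of \<open>D\<close>.\<close>
      unfolding nondegenerate_def using nd D_zero D_skew by (metis neg_equal_0_iff_equal)
  next
    fix X Y x y assume "X \<in> G x" "Y \<in> G y"
    then show "B (D X) Y = - (ksign (x * y) * B (D Y) X)"
      using supersymmetric_B[of X x "D Y" y] D_mem[of Y y] by (simp add: D_skew[of X Y])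
  next
    fix X Y Z x y z assume mem: "X \<in> G x" "Y \<in> G y" "Z \<in> G z"
    \<comment> \<open>Moving \<open>D\<close> onto \<open>br Y Z\<close>, applying the Leibniz rule
      and regrouping by invariance leaves two terms. The steps below turn them into the other two
      cocycle terms, up to signs.\<close>
    have "B (D X) (br Y Z) = - B X (br (D Y) Z) - B (br X Y) (D Z)"
      by (simp add: D_skew[of X] D_br invariant_B)
    also have "B (br X Y) (D Z) = ksign ((x + y) * z) * B (D Z) (br X Y)"
      using supersymmetric_B even_bracket mem D_mem by blast
    also have "B X (br (D Y) Z) = - (ksign (y * z) * B (br X Z) (D Y))"
      using skew_bracket[OF D_mem[OF mem(2)] mem(3)] by (simp add: invariant_B)
    also have "B (br X Z) (D Y) = - (ksign (x * z) * B (br Z X) (D Y))"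
      using skew_bracket[OF mem(1,3)] by simp
    also have "B (br Z X) (D Y) = ksign ((z + x) * y) * B (D Y) (br Z X)"
      using supersymmetric_B even_bracket mem D_mem by blast
    finally show "ksign (x * z) * B (D X) (br Y Z) + ksign (y * x) * B (D Y) (br Z X)
        + ksign (z * y) * B (D Z) (br X Y) = 0"
      \<comment> \<open>The signs are compared in the eight parity cases.\<close>
      by (cases x; cases y; cases z)
        (simp_all add: ksign_def)
  qed
qed

end

section \<open>Quadratic structure on the odd double extension\<close>

locale odd_double_extension = quadratic_lie_superalgebra smul purely_even br B
  for smul :: "'k::field \<Rightarrow> 'v::ab_group_add \<Rightarrow> 'v"
    and br :: "'v \<Rightarrow> 'v \<Rightarrow> 'v"
    and B :: "'v \<Rightarrow> 'v \<Rightarrow> 'k" +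
  fixes X\<^sub>0 :: 'v
  assumes X0_central: "X\<^sub>0 \<in> center br"
    and X0_isotropic [simp]: "B X\<^sub>0 X\<^sub>0 = 0"
begin

abbreviation "scale\<^sub>E \<equiv> dext_scale smul"
abbreviation "grading\<^sub>E \<equiv> dext_grading smul"
abbreviation "bracket\<^sub>E \<equiv> dext_bracket smul br B X\<^sub>0"
abbreviation "form\<^sub>E \<equiv> dext_form B"

lemmas scale_triple [simp] = dext_scale_triple[OF vector_space_axioms]

lemma bracket_skew: "br X Y = - br Y X"
  using skew_bracket[of X 0 Y 0] by (simp add: purely_even_def ksign_def)

lemma form_commute: "B X Y = B Y X"
  using supersymmetric_B[of X 0 Y 0] by (simp add: purely_even_def ksign_def)

lemma bracket_jacobi: "br X (br Y Z) + br Y (br Z X) + br Z (br X Y) = 0"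
  using jacobi[of X 0 Y 0 Z 0] by (simp add: purely_even_def ksign_def)

lemma bracket_X0 [simp]: "br X\<^sub>0 X = 0" "br X X\<^sub>0 = 0"
  using X0_central bracket_skew[of X X\<^sub>0] by (simp_all add: center_def)

text \<open>Invariance moves the bracket onto the central \<open>X\<^sub>0\<close>. Together with
  isotropy this kills the \<open>dext_estar\<close> component of every nested bracket in the
  extension.\<close>

lemma form_bracket_X0 [simp]: "B (br X Y) X\<^sub>0 = 0"
  by (simp add: invariant_B)

lemma vector_space_dext: "vector_space scale\<^sub>E"
  by unfold_locales (auto simp: scale_right_distrib scale_left_distrib algebra_simps)

sublocale E: vector_space scale\<^sub>E
  by (rule vector_space_dext)

lemma span_e_estar: "E.span {dext_e, dext_estar} = {(a, 0, b) | a b. True}"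
  by (auto simp: E.span_insert E.span_singleton dext_e_def dext_estar_def image_iff)

lemma span_estar: "E.span {dext_estar} = {(0, 0, b) | b. True}"
  by (auto simp: E.span_singleton dext_estar_def)

text \<open>Homogeneity becomes vanishing of coordinates, so the graded axioms can be checked by
  cases on parities.\<close>

lemma mem_grading_iff: "(a, X, b) \<in> grading\<^sub>E x \<longleftrightarrow> (if x = 0 then a = 0 \<and> b = 0 else X = 0)"
  by (auto simp: dext_grading_def span_e_estar dext_incl_def)

lemma quadratic_dext: "quadratic_lie_superalgebra scale\<^sub>E grading\<^sub>E bracket\<^sub>E form\<^sub>E"
proof unfold_locales
  fix x show "E.subspace (grading\<^sub>E x)"
    by (auto simp: E.subspace_def mem_grading_iff zero_prod_def split: if_splits)
next
  show "grading\<^sub>E 0 \<inter> grading\<^sub>E 1 = {0}"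
    by (auto simp: mem_grading_iff zero_prod_def)
next
  fix Z :: "'k \<times> 'v \<times> 'k"
  obtain a X b where "Z = (0, X, 0) + (a, 0, b)" by (cases Z) auto
  then show "\<exists>X\<in>grading\<^sub>E 0. \<exists>Y\<in>grading\<^sub>E 1. Z = X + Y"
    by (metis mem_grading_iff zero_neq_one)
next
  show "bilinear_map scale\<^sub>E scale\<^sub>E bracket\<^sub>E"
    by (simp add: bilinear_map_iff[OF vector_space_dext vector_space_dext] algebra_simps
        scale_right_distrib scale_left_distrib)
next
  fix X Y x y assume "X \<in> grading\<^sub>E x" "Y \<in> grading\<^sub>E y"
  then show "bracket\<^sub>E X Y \<in> grading\<^sub>E (x + y)"
    by (cases X; cases Y; cases x; cases y)
      (simp_all add: mem_grading_iff)
next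
  fix X Y x y assume "X \<in> grading\<^sub>E x" "Y \<in> grading\<^sub>E y"
  then show "bracket\<^sub>E X Y = - scale\<^sub>E (ksign (x * y)) (bracket\<^sub>E Y X)"
    by (cases X; cases Y; cases x; cases y)
      (auto simp: mem_grading_iff ksign_def mult.commute intro: bracket_skew)
next
  \<comment> \<open>A nested bracket in the extension is the nested bracket of the middle
    components. It vanishes as soon as one argument is odd; three even arguments give the Jacobi
    identity of \<open>br\<close>.\<close>
  fix X Y Z x y z assume "X \<in> grading\<^sub>E x" "Y \<in> grading\<^sub>E y" "Z \<in> grading\<^sub>E z"
  then show "scale\<^sub>E (ksign (x * z)) (bracket\<^sub>E X (bracket\<^sub>E Y Z))
      + scale\<^sub>E (ksign (x * y)) (bracket\<^sub>E Y (bracket\<^sub>E Z X))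
      + scale\<^sub>E (ksign (y * z)) (bracket\<^sub>E Z (bracket\<^sub>E X Y)) = 0"
    by (cases X; cases Y; cases Z;
        cases x; cases y; cases z)
      (simp_all add: mem_grading_iff ksign_def bracket_jacobi zero_prod_def)
next
  show "bilinear_map scale\<^sub>E (*) form\<^sub>E"
    by (simp add: bilinear_map_iff[OF vector_space_dext vector_space_field] algebra_simps)
next
  show "even_form grading\<^sub>E form\<^sub>E"
    by (auto simp: even_form_def mem_grading_iff)
next
  have nd: "X = 0" if "\<And>Y. B X Y = 0" for X
    using nondegenerate_B that by (simp add: nondegenerate_def)
  have "X = 0" if *: "\<And>Y. form\<^sub>E X Y = 0" for X
  proof (cases X)
    case (fields a X' b)
    \<comment> \<open>Even vectors detect the middle coordinate; pairing with \<open>dext_e\<close>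
      then gives \<open>b\<close>, and with \<open>dext_estar\<close> gives
      \<open>- a\<close>.\<close>
    have "B X' Y = 0" for Y using *[of "(0, Y, 0)"] fields by simp
    then show ?thesis
      using *[of "(1, 0, 0)"] *[of "(0, 0, 1)"] fields nd by (simp add: zero_prod_def)
  qed
  moreover have "X = 0" if *: "\<And>Y. form\<^sub>E Y X = 0" for X
  proof (cases X)
    case (fields a X' b)
    have "B X' Y = 0" for Y using *[of "(0, Y, 0)"] fields by (simp add: form_commute)
    then show ?thesis
      using *[of "(1, 0, 0)"] *[of "(0, 0, 1)"] fields nd by (simp add: zero_prod_def)
  qed
  ultimately show "nondegenerate form\<^sub>E"
    unfolding nondegenerate_def by blast
next
  fix X Y x y assume "X \<in> grading\<^sub>E x" "Y \<in> grading\<^sub>E y"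
  then show "form\<^sub>E X Y = ksign (x * y) * form\<^sub>E Y X"
    by (cases X; cases Y; cases x; cases y)
      (auto simp: mem_grading_iff ksign_def mult.commute intro: form_commute)
next
  fix X Y Z show "form\<^sub>E (bracket\<^sub>E X Y) Z = form\<^sub>E X (bracket\<^sub>E Y Z)"
    \<comment> \<open>The multiple of \<open>X\<^sub>0\<close> in \<open>bracket\<^sub>E X Y\<close>
      pairs with \<open>Z\<close> from the left, whereas the same product on the other side has
      \<open>X\<^sub>0\<close> second; symmetry at \<open>X\<^sub>0\<close> reconciles them.\<close>
    by (cases X; cases Y; cases Z) (simp add: invariant_B form_commute[of X\<^sub>0] algebra_simps)
qed

section \<open>The odd part as a filiform module\<close>

lemma filiform_dext:
  assumes "X\<^sub>0 \<noteq> 0"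
  shows "filiform_flag scale\<^sub>E grading\<^sub>E bracket\<^sub>E 2 (dext_flag smul)"
proof -
  have flag: "dext_flag smul 0 = {0}" "dext_flag smul 1 = E.span {dext_estar}"
    "dext_flag smul 2 = E.span {dext_e, dext_estar}"
    by (simp_all add: dext_flag_def)
  have "dext_e \<noteq> (0 :: 'k \<times> 'v \<times> 'k)" and estar: "dext_estar \<noteq> (0 :: 'k \<times> 'v \<times> 'k)"
    by (simp_all add: dext_e_def dext_estar_def zero_prod_def)
  have e: "dext_e \<notin> E.span {dext_estar}"
    by (simp add: span_estar dext_e_def)
  have ind: "E.independent {dext_e, dext_estar}"
    using e estar by (simp add: E.independent_insert)
  have ne: "dext_e \<noteq> (dext_estar :: 'k \<times> 'v \<times> 'k)"
    by (simp add: dext_e_def dext_estar_def)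
  have dims: "E.dim (dext_flag smul 0) = 0" "E.dim (dext_flag smul 1) = 1"
    "E.dim (dext_flag smul 2) = 2"
    using E.dim_span_eq_card_independent[OF ind] E.dim_span_eq_card_independent[of "{dext_estar}"]
      E.dim_span_eq_card_independent[of "{}"] estar ne E.independent_empty
    unfolding flag by simp_all
  have zero: "bracket_span scale\<^sub>E bracket\<^sub>E (grading\<^sub>E 0) (dext_flag smul 1) = dext_flag smul 0"
  proof -
    have "{bracket\<^sub>E X Y | X Y. X \<in> grading\<^sub>E 0 \<and> Y \<in> dext_flag smul 1} \<subseteq> {0}"
      (is "?S \<subseteq> _")
      unfolding flag span_estar by (auto simp: mem_grading_iff zero_prod_def)
    \<comment> \<open>Both alternatives span \<open>{0}\<close>, so no bracket has to be
      exhibited.\<close>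
    then have "?S = {} \<or> ?S = {0}"
      by (rule subset_singletonD)
    then show ?thesis
      unfolding bracket_span_def flag(1)
      by (elim disjE; simp only: E.span_empty E.span_insert_0)
  qed
  obtain X where X: "B X X\<^sub>0 \<noteq> 0"
    using nondegenerate_B assms by (auto simp: nondegenerate_def)
  have one: "bracket_span scale\<^sub>E bracket\<^sub>E (grading\<^sub>E 0) (dext_flag smul 2) = dext_flag smul 1"
  proof -
    \<comment> \<open>The coefficient of \<open>dext_e\<close> cancels the factor
      \<open>B X X\<^sub>0\<close>. The brackets thus already fill the line of
      \<open>dext_estar\<close>, and taking the span adds nothing.\<close>
    have "(0, 0, b) = bracket\<^sub>E (0, X, 0) (b / B X X\<^sub>0, 0, 0)" for b
      using X by simp
    then have "(0, 0, b) \<in> {bracket\<^sub>E X Y | X Y. X \<in> grading\<^sub>E 0 \<and> Y \<in> dext_flag smul 2}" for b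
      unfolding flag span_e_estar mem_Collect_eq by (metis mem_grading_iff)
    then have "{bracket\<^sub>E X Y | X Y. X \<in> grading\<^sub>E 0 \<and> Y \<in> dext_flag smul 2} = E.span {dext_estar}"
      unfolding flag span_e_estar span_estar by (auto simp: mem_grading_iff)
    then show ?thesis
      unfolding bracket_span_def flag by simp
  qed
  have sub: "dext_flag smul 0 \<subset> dext_flag smul 1" "dext_flag smul 1 \<subset> dext_flag smul 2"
    unfolding flag using E.span_zero estar E.span_base[of dext_estar "{dext_estar}"]
      E.span_mono[of "{dext_estar}" "{dext_e, dext_estar}"] e
      E.span_base[of dext_e "{dext_e, dext_estar}"] by auto
  have le2: "i \<le> 2 \<longleftrightarrow> i = 0 \<or> i = 1 \<or> i = 2" and lt2: "i < 2 \<longleftrightarrow> i = 0 \<or> i = 1" for i :: nat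
    by auto
  have "E.subspace (dext_flag smul i)" for i
    by (simp add: dext_flag_def E.subspace_single_0)
  then show ?thesis
    using dims zero one sub
    by (auto simp: filiform_flag_def le2 lt2 numeral_2_eq_2 dext_grading_def dext_flag_def)
qed

section \<open>The extended derivation\<close>

lemma bij_dext_deriv:
  fixes \<delta> :: "'v \<Rightarrow> 'v" and c :: 'k
  assumes "bij \<delta>" and "c \<noteq> 0" and "(2::'k) \<noteq> 0"
  shows "bij (dext_deriv c \<delta>)"
\<comment> \<open>The inverse divides the outer coordinates by the eigenvalues \<open>c / 2\<close>
  and \<open>- (c / 2)\<close>, which are nonzero outside characteristic 2.\<close>
proof (rule bij_betw_byWitness[where f' = "\<lambda>(a, X, b). (a / (c / 2), inv \<delta> X, - b / (c / 2))"])
qed (use assms in \<open>auto simp: bij_is_inj bij_is_surj surj_f_inv_f\<close>)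

text \<open>\<open>dext_e\<close> and \<open>dext_estar\<close> are isotropic and paired with each
  other, and their eigenvalues are opposite, so the new terms cancel.\<close>

lemma skew_dext_deriv:
  assumes "skew_supersymmetric B \<delta>"
  shows "skew_supersymmetric form\<^sub>E (dext_deriv c \<delta>)"
  using assms by (simp add: skew_supersymmetric_def algebra_simps)

text \<open>On \<open>[e,e]\<close> the rule reads \<open>c = c / 2 + c / 2\<close>. On
  \<open>[X,e]\<close> it reads \<open>- (c / 2) = - c + c / 2\<close>, where \<open>- c\<close>
  comes from moving \<delta> across \<open>B\<close> onto the eigenvector
  \<open>X\<^sub>0\<close>.\<close>

lemma superderivation_dext_deriv:
  assumes der: "even_superderivation smul purely_even br \<delta>" and skew: "skew_supersymmetric B \<delta>"
    and eig: "\<delta> X\<^sub>0 = smul c X\<^sub>0" and two: "(2::'k) \<noteq> 0"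
  shows "even_superderivation scale\<^sub>E grading\<^sub>E bracket\<^sub>E (dext_deriv c \<delta>)"
proof -
  have lin: "\<delta> (X + Y) = \<delta> X + \<delta> Y" "\<delta> (smul a X) = smul a (\<delta> X)" for X Y a
    using der by (simp_all add: even_superderivation_def
        linear_iff_vector_space[OF vector_space_axioms vector_space_axioms])
  have zero: "\<delta> 0 = 0"
    using lin(1)[of 0 0] by simp
  have br: "\<delta> (br X Y) = br (\<delta> X) Y + br X (\<delta> Y)" for X Y
    using der by (simp add: even_superderivation_def)
  have form: "B (\<delta> X) X\<^sub>0 = - (c * B X X\<^sub>0)" for X
    using skew by (simp add: skew_supersymmetric_def eig)
  have half: "c = c / 2 + c / 2"
    using two by (simp add: field_simps)
  have "Vector_Spaces.linear scale\<^sub>E scale\<^sub>E (dext_deriv c \<delta>)"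
    by (simp add: linear_iff_vector_space[OF vector_space_dext vector_space_dext] lin algebra_simps)
  moreover have "dext_deriv c \<delta> ` grading\<^sub>E x \<subseteq> grading\<^sub>E x" for x
    by (auto simp: mem_grading_iff zero split: if_splits)
  moreover have "dext_deriv c \<delta> (bracket\<^sub>E X Y)
      = bracket\<^sub>E (dext_deriv c \<delta> X) Y + bracket\<^sub>E X (dext_deriv c \<delta> Y)" for X Y
  proof (cases X; cases Y)
    fix a X' b a' Y' b' assume *: "X = (a, X', b)" "Y = (a', Y', b')"
    have "smul (a * a' * c) X\<^sub>0 = smul (a * a' * (c / 2)) X\<^sub>0 + smul (a * a' * (c / 2)) X\<^sub>0"
      by (metis half distrib_left scale_left_distrib)
    \<comment> \<open>This is the \<open>dext_estar\<close> component of the rule, with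
      \<open>h\<close> for \<open>c / 2\<close> and \<open>r\<close>, \<open>s\<close> for the
      products of the middle components with \<open>X\<^sub>0\<close>. Folding \<open>half\<close>
      afterwards restores \<open>c\<close> in place of \<open>h + h\<close>.\<close>
    moreover have "- h * (a' * r - a * s) =
        (a' * - ((h + h) * r) - h * a * s) + (h * a' * r - a * - ((h + h) * s))" for h r s
      by (simp add: algebra_simps)
    note this[of "c / 2", folded half]
    ultimately show ?thesis
      by (simp add: * lin br form eig two algebra_simps)
  qed
  ultimately show ?thesis
    by (simp add: even_superderivation_def)
qed

end

theorem theorem5p1:
  fixes smul :: "'k::field_char_0 \<Rightarrow> 'v::ab_group_add \<Rightarrow> 'v"
    and br :: "'v \<Rightarrow> 'v \<Rightarrow> 'v"
    and B \<omega> :: "'v \<Rightarrow> 'v \<Rightarrow> 'k"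
    and \<delta> :: "'v \<Rightarrow> 'v"
    and X\<^sub>0 :: 'v
    and \<beta> :: 'k
  assumes "quadratic_symplectic_lie_algebra smul br B \<omega>"
    and "\<exists>Basis. finite_dimensional_vector_space smul Basis"
    and "X\<^sub>0 \<in> center br - {0}"
    and "B X\<^sub>0 X\<^sub>0 = 0"
    and "even_superderivation smul purely_even br \<delta>"
    and "bij \<delta>"
    and "skew_supersymmetric B \<delta>"
    and "\<And>X Y. \<omega> X Y = B (\<delta> X) Y"
    and "\<beta> \<noteq> 0"
    and "\<delta> X\<^sub>0 = smul \<beta> X\<^sub>0"
  shows "even_superderivation (dext_scale smul) (dext_grading smul)
           (dext_bracket smul br B X\<^sub>0) (dext_deriv \<beta> \<delta>)
         \<and> bij (dext_deriv \<beta> \<delta>)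
         \<and> skew_supersymmetric (dext_form B) (dext_deriv \<beta> \<delta>)
         \<and> quadratic_symplectic_lie_superalgebra (dext_scale smul) (dext_grading smul)
           (dext_bracket smul br B X\<^sub>0) (dext_form B)
           (\<lambda>X Y. dext_form B (dext_deriv \<beta> \<delta> X) Y)
         \<and> filiform_type (dext_scale smul) (dext_grading smul) (dext_bracket smul br B X\<^sub>0)
         \<and> filiform_flag (dext_scale smul) (dext_grading smul) (dext_bracket smul br B X\<^sub>0)
           2 (dext_flag smul)"
proof -
  interpret base: quadratic_symplectic_lie_superalgebra smul purely_even br B \<omega>
    by fact
  interpret odd_double_extension smul br B X\<^sub>0
    using assms(3,4) by unfold_locales auto
  \<comment> \<open>Characteristic zero supplies the premise that 2 is nonzero, here and for
    bijectivity.\<close>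
  have der: "even_superderivation scale\<^sub>E grading\<^sub>E bracket\<^sub>E (dext_deriv \<beta> \<delta>)"
    using assms by (simp add: superderivation_dext_deriv)
  have bij: "bij (dext_deriv \<beta> \<delta>)"
    using assms by (simp add: bij_dext_deriv)
  have skew: "skew_supersymmetric form\<^sub>E (dext_deriv \<beta> \<delta>)"
    using assms by (simp add: skew_dext_deriv)
  have flag: "filiform_flag scale\<^sub>E grading\<^sub>E bracket\<^sub>E 2 (dext_flag smul)"
    using assms by (simp add: filiform_dext)
  show ?thesis
    \<comment> \<open>The general construction of symplectic forms is applied to the extension
      itself, with the extended derivation as \<open>D\<close>.\<close>
    using der bij skew flag
      quadratic_lie_superalgebra.symplectic_of_superderivation[OF quadratic_dext der bij skew]
    by (auto simp: filiform_type_def)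
qed

end
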